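(* Let $\mu>0$, $R_t,R_n>0$, $R=\mathrm{diag}(R_t,R_t,R_n)$, and $\mathcal F=\{(x_t,x_n)\in\mathbb R^2\times\mathbb R:\|x_t\|\le\mu x_n\}$. For $y=(y_t,y_n)\in\mathbb R^2\times\mathbb R$ let $$P_{\mathcal F}(y)=\arg\min_{\gamma\in\mathcal F}\tfrac12(\gamma-y)^TR(\gamma-y).$$ Put $y_r=\|y_t\|$, $\hat t=y_t/y_r$ (when $y_r\neq0$), $\tilde\mu=\mu(R_t/R_n)^{1/2}$ and $\hat\mu=\mu R_t/R_n$. Then $$P_{\mathcal F}(y)=\begin{cases} y & \text{if } y_r\le\mu y_n,\\[2pt] (\mu\gamma_n\hat t,\ \gamma_n)\ \text{ with }\ \gamma_n=\dfrac{1}{1+\tilde\mu^2}\,(y_n+\hat\mu y_r) & \text{if } -\hat\mu y_r<y_n\le y_r/\mu,\\[6pt] 0 & \text{if } y_n<-\hat\mu y_r.\end{cases}$$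
   Context: $\|\cdot\|$ denotes the Euclidean norm. $P_{\mathcal F}$ is the projection onto the closed convex cone $\mathcal F$ with respect to the norm $\|z\|_R=(z^TRz)^{1/2}$. The three cases correspond to stiction, sliding and no contact. *)

theory Defs
  imports "HOL-Analysis.Analysis"
begin

text \<open>
  Points of \<open>\<real>\<^sup>2 \<times> \<real>\<close> are pairs (tangential part, normal part). \<open>stack\<close> is the identification
  with \<open>\<real>\<^sup>3\<close> under which the 3x3 matrix \<open>R\<close> acts on them.
\<close>

definition stack :: "(real^2) \<times> real \<Rightarrow> real^3" where
  "stack z = vector [fst z $ 1, fst z $ 2, snd z]"

definition diag :: "real^'n \<Rightarrow> real^'n^'n" where
  "diag v = (\<chi> i j. if i = j then v $ i else 0)"

definition friction_cone :: "real \<Rightarrow> ((real^2) \<times> real) set" where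
  "friction_cone \<mu> = {(x\<^sub>t, x\<^sub>n). norm x\<^sub>t \<le> \<mu> * x\<^sub>n}"

definition proj_objective :: "real^3^3 \<Rightarrow> (real^2) \<times> real \<Rightarrow> (real^2) \<times> real \<Rightarrow> real" where
  "proj_objective R y \<gamma> = 1 / 2 * (stack (\<gamma> - y) \<bullet> (R *v stack (\<gamma> - y)))"

text \<open>
  \<open>arg_min_on\<close> is a choice operator: the value is meaningful only where the minimiser exists
  and is unique.
\<close>

definition proj :: "real^3^3 \<Rightarrow> ((real^2) \<times> real) set \<Rightarrow> (real^2) \<times> real \<Rightarrow> (real^2) \<times> real" where
  "proj R F y = arg_min_on (proj_objective R y) F"

end

theory Submission
  imports Defs
begin

text \<open>
  A point \<open>p\<close> of the cone is the projection of \<open>y\<close> as soon as \<open>y - p\<close> makes an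
  \<open>R\<close>-obtuse angle with \<open>\<gamma> - p\<close> for every \<open>\<gamma>\<close> in the cone. In the sliding case the residual
  \<open>y - p\<close> is \<open>s\<close> times \<open>(t_hat, - \<mu> R\<^sub>t / R\<^sub>n)\<close> with \<open>s = y\<^sub>r - \<mu> \<gamma>\<^sub>n \<ge> 0\<close>, a generator of the polar
  cone, so that the angle condition is the Cauchy-Schwarz inequality.
\<close>

lemma proj_objective_diag:
  "proj_objective (diag (vector [a, a, b])) y \<gamma>
    = 1 / 2 * (a * (norm (fst \<gamma> - fst y))\<^sup>2 + b * (snd \<gamma> - snd y)\<^sup>2)"
  unfolding power2_norm_eq_inner
  by (simp add: proj_objective_def diag_def stack_def inner_vec_def matrix_vector_mult_def
      sum_2 sum_3 power2_eq_square algebra_simps)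

text \<open>Expanding about \<open>p\<close>, the objective at \<gamma> exceeds that at
  \<open>p\<close> by half the squared R-norm of \<gamma> - p, which is positive, minus the R-inner
  product of \<gamma> - p and y - p, which \<open>obtuse\<close> makes nonpositive.\<close>

lemma proj_objective_strict_min:
  assumes pos: "a > 0" "b > 0" and "\<gamma> \<noteq> p"
    and obtuse: "a * ((fst \<gamma> - fst p) \<bullet> (fst y - fst p)) + b * ((snd \<gamma> - snd p) * (snd y - snd p)) \<le> 0"
  shows "proj_objective (diag (vector [a, a, b])) y p
    < proj_objective (diag (vector [a, a, b])) y \<gamma>"
proof -
  have expand: "(norm (fst \<gamma> - fst y))\<^sup>2 = (norm (fst p - fst y))\<^sup>2 + (norm (fst \<gamma> - fst p))\<^sup>2
      - 2 * ((fst \<gamma> - fst p) \<bullet> (fst y - fst p))"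
    by (simp add: power2_norm_eq_inner inner_diff_left inner_diff_right inner_commute)
  have "fst \<gamma> \<noteq> fst p \<or> snd \<gamma> \<noteq> snd p"
    using \<open>\<gamma> \<noteq> p\<close> by (simp add: prod_eq_iff)
  then have "0 < a * (norm (fst \<gamma> - fst p))\<^sup>2 + b * (snd \<gamma> - snd p)\<^sup>2"
    using pos by (auto intro: add_pos_nonneg add_nonneg_pos)
  then show ?thesis
    using obtuse unfolding proj_objective_diag expand
    by (simp add: power2_eq_square algebra_simps)
qed

text \<open>The equivalence carries existence and uniqueness at once, so it both yields the unique
  minimiser and determines the choice operator behind \<open>proj\<close>.\<close>

lemma is_arg_min_proj_iff:
  assumes "a > 0" "b > 0" "p \<in> F"
    and "\<And>\<gamma>. \<gamma> \<in> F \<Longrightarrow>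
      a * ((fst \<gamma> - fst p) \<bullet> (fst y - fst p)) + b * ((snd \<gamma> - snd p) * (snd y - snd p)) \<le> 0"
  shows "is_arg_min (proj_objective (diag (vector [a, a, b])) y) (\<lambda>\<gamma>. \<gamma> \<in> F) q \<longleftrightarrow> q = p"
  using proj_objective_strict_min[of a b _ p y] assms unfolding is_arg_min_def
  by (metis order_less_asym)

lemma proj_eqI:
  assumes "\<And>q. is_arg_min (proj_objective R y) (\<lambda>\<gamma>. \<gamma> \<in> F) q \<longleftrightarrow> q = p"
  shows "proj R F y = p"
  using assms by (simp add: proj_def arg_min_on_def arg_min_def)

text \<open>Here y lies in the R-polar cone: by Cauchy-Schwarz its R-inner product with any \<gamma>
  of the cone is at most \<open>snd \<gamma> * (\<mu> * a * norm y\<^sub>t + b * y\<^sub>n)\<close>,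
  which \<open>sep\<close> makes nonpositive.\<close>

lemma arg_min_friction_cone_separation:
  fixes a b \<mu> y\<^sub>n :: real
  assumes "\<mu> > 0" "a > 0" "b > 0" and sep: "b * y\<^sub>n \<le> - (\<mu> * a * norm y\<^sub>t)"
  shows "is_arg_min (proj_objective (diag (vector [a, a, b])) (y\<^sub>t, y\<^sub>n))
    (\<lambda>\<gamma>. \<gamma> \<in> friction_cone \<mu>) q \<longleftrightarrow> q = 0"
proof (rule is_arg_min_proj_iff)
  fix \<gamma> :: "(real^2) \<times> real"
  assume "\<gamma> \<in> friction_cone \<mu>"
  then have cone: "norm (fst \<gamma>) \<le> \<mu> * snd \<gamma>"
    by (auto simp: friction_cone_def)
  then have "0 \<le> snd \<gamma>"
    using \<open>\<mu> > 0\<close> by (metis norm_ge_zero order_trans zero_le_mult_iff not_less)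
  then have 1: "snd \<gamma> * (b * y\<^sub>n) \<le> snd \<gamma> * - (\<mu> * a * norm y\<^sub>t)"
    using sep by (rule mult_left_mono[rotated])
  have "fst \<gamma> \<bullet> y\<^sub>t \<le> \<mu> * snd \<gamma> * norm y\<^sub>t"
    using norm_cauchy_schwarz cone by (meson mult_right_mono norm_ge_zero order_trans)
  then have "a * (fst \<gamma> \<bullet> y\<^sub>t) \<le> a * (\<mu> * snd \<gamma> * norm y\<^sub>t)"
    using \<open>a > 0\<close> by simp
  with 1 show "a * ((fst \<gamma> - fst 0) \<bullet> (fst (y\<^sub>t, y\<^sub>n) - fst 0))
      + b * ((snd \<gamma> - snd 0) * (snd (y\<^sub>t, y\<^sub>n) - snd 0)) \<le> 0"
    by (simp add: algebra_simps)
qed (use assms in \<open>auto simp: friction_cone_def zero_prod_def\<close>)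

text \<open>\<open>stationary\<close> says that the objective restricted to the ray through (\<mu>
  t, 1) has zero derivative at \<open>g\<close>, so the residual is R-orthogonal to that
  ray.\<close>

lemma arg_min_friction_cone_sliding:
  fixes a b \<mu> g r y\<^sub>n :: real
  assumes "\<mu> > 0" "a > 0" "b > 0" and t: "norm t = 1" and "0 \<le> g" "\<mu> * g \<le> r"
    and stationary: "b * (g - y\<^sub>n) = \<mu> * a * (r - \<mu> * g)"
  shows "is_arg_min (proj_objective (diag (vector [a, a, b])) (r *\<^sub>R t, y\<^sub>n))
    (\<lambda>\<gamma>. \<gamma> \<in> friction_cone \<mu>) q \<longleftrightarrow> q = ((\<mu> * g) *\<^sub>R t, g)"
proof (rule is_arg_min_proj_iff)
  fix \<gamma> :: "(real^2) \<times> real"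
  assume "\<gamma> \<in> friction_cone \<mu>"
  then have "norm (fst \<gamma>) \<le> \<mu> * snd \<gamma>"
    by (auto simp: friction_cone_def)
  then have cone: "fst \<gamma> \<bullet> t - \<mu> * snd \<gamma> \<le> 0"
    using norm_cauchy_schwarz[of "fst \<gamma>" t] t by simp
  have tt: "t \<bullet> t = 1"
    using t by (simp add: norm_eq_1)
  have "(fst \<gamma> - (\<mu> * g) *\<^sub>R t) \<bullet> (r *\<^sub>R t - (\<mu> * g) *\<^sub>R t)
      = (r - \<mu> * g) * (fst \<gamma> \<bullet> t - \<mu> * g)"
    by (simp add: inner_diff_left inner_diff_right tt algebra_simps)
  moreover have "b * ((snd \<gamma> - g) * (y\<^sub>n - g)) = - (snd \<gamma> - g) * (\<mu> * a * (r - \<mu> * g))"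
    unfolding stationary[symmetric] by (simp add: algebra_simps)
  \<comment> \<open>The terms in \<mu> * g cancel by this orthogonality; what is left is a
    nonnegative factor times the cone constraint tested against \<open>t\<close>.\<close>
  ultimately have "a * ((fst \<gamma> - (\<mu> * g) *\<^sub>R t) \<bullet> (r *\<^sub>R t - (\<mu> * g) *\<^sub>R t))
      + b * ((snd \<gamma> - g) * (y\<^sub>n - g)) = a * (r - \<mu> * g) * (fst \<gamma> \<bullet> t - \<mu> * snd \<gamma>)"
    by (simp add: tt algebra_simps)
  also have "\<dots> \<le> 0"
    using cone assms by (simp add: mult_nonneg_nonpos)
  finally show "a * ((fst \<gamma> - fst ((\<mu> * g) *\<^sub>R t, g)) \<bullet> (fst (r *\<^sub>R t, y\<^sub>n) - fst ((\<mu> * g) *\<^sub>R t, g)))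
      + b * ((snd \<gamma> - snd ((\<mu> * g) *\<^sub>R t, g)) * (snd (r *\<^sub>R t, y\<^sub>n) - snd ((\<mu> * g) *\<^sub>R t, g))) \<le> 0"
    by simp
qed (use assms in \<open>auto simp: friction_cone_def\<close>)

theorem mainTheorem3:
  fixes \<mu> R\<^sub>t R\<^sub>n y\<^sub>n y\<^sub>r \<mu>_tilde \<mu>_hat \<gamma>\<^sub>n :: real
    and R :: "real^3^3"
    and F :: "((real^2) \<times> real) set"
    and y\<^sub>t t_hat :: "real^2"
  assumes "\<mu> > 0" and "R\<^sub>t > 0" and "R\<^sub>n > 0"
    and "R = diag (vector [R\<^sub>t, R\<^sub>t, R\<^sub>n])"
    and "F = friction_cone \<mu>"
    and "y\<^sub>r = norm y\<^sub>t"
    and "y\<^sub>r \<noteq> 0 \<longrightarrow> t_hat = y\<^sub>t /\<^sub>R y\<^sub>r"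
    and "\<mu>_tilde = \<mu> * sqrt (R\<^sub>t / R\<^sub>n)"
    and "\<mu>_hat = \<mu> * R\<^sub>t / R\<^sub>n"
    and "\<gamma>\<^sub>n = 1 / (1 + \<mu>_tilde\<^sup>2) * (y\<^sub>n + \<mu>_hat * y\<^sub>r)"
  shows "(\<exists>!\<gamma>. is_arg_min (proj_objective R (y\<^sub>t, y\<^sub>n)) (\<lambda>\<gamma>. \<gamma> \<in> F) \<gamma>)
    \<and> (y\<^sub>r \<le> \<mu> * y\<^sub>n \<longrightarrow> proj R F (y\<^sub>t, y\<^sub>n) = (y\<^sub>t, y\<^sub>n))
    \<and> (- \<mu>_hat * y\<^sub>r < y\<^sub>n \<and> y\<^sub>n \<le> y\<^sub>r / \<mu> \<longrightarrow>
        proj R F (y\<^sub>t, y\<^sub>n) = ((\<mu> * \<gamma>\<^sub>n) *\<^sub>R t_hat, \<gamma>\<^sub>n))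
    \<and> (y\<^sub>n < - \<mu>_hat * y\<^sub>r \<longrightarrow> proj R F (y\<^sub>t, y\<^sub>n) = 0)"
proof -
  let ?argmin = "\<lambda>p. \<forall>q. is_arg_min (proj_objective R (y\<^sub>t, y\<^sub>n)) (\<lambda>\<gamma>. \<gamma> \<in> F) q \<longleftrightarrow> q = p"
  \<comment> \<open>Here y itself lies in the cone and the residual vanishes, so the angle condition
    is trivial.\<close>
  have stiction: "?argmin (y\<^sub>t, y\<^sub>n)" if "y\<^sub>r \<le> \<mu> * y\<^sub>n"
    unfolding assms(4)
    by (intro allI is_arg_min_proj_iff) (use assms that in \<open>auto simp: friction_cone_def\<close>)
  have sliding: "?argmin ((\<mu> * \<gamma>\<^sub>n) *\<^sub>R t_hat, \<gamma>\<^sub>n)"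
    if lower: "- \<mu>_hat * y\<^sub>r < y\<^sub>n" and upper: "y\<^sub>n \<le> y\<^sub>r / \<mu>"
  proof -
    have upper': "\<mu> * y\<^sub>n \<le> y\<^sub>r"
      using upper \<open>\<mu> > 0\<close> by (simp add: field_simps)
    \<comment> \<open>Otherwise the two bounds would read 0 < y_n \<le> 0.\<close>
    have "y\<^sub>r \<noteq> 0"
      using lower upper by auto
    then have t_hat: "t_hat = y\<^sub>t /\<^sub>R y\<^sub>r"
      using assms(7) by simp
    have y: "y\<^sub>t = y\<^sub>r *\<^sub>R t_hat"
      using \<open>y\<^sub>r \<noteq> 0\<close> t_hat by simp
    have "norm t_hat = 1"
      using \<open>y\<^sub>r \<noteq> 0\<close> t_hat assms(6) by simp
    \<comment> \<open>Both derived coefficients are expressed through this ratio, which removes the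
      square root.\<close>
    define k where "k = R\<^sub>t / R\<^sub>n"
    have "k > 0" and Rt: "R\<^sub>t = R\<^sub>n * k"
      using assms(2,3) by (simp_all add: k_def)
    have hat: "\<mu>_hat = \<mu> * k"
      using assms(9) by (simp add: k_def)
    have tilde: "\<mu>_tilde\<^sup>2 = \<mu>\<^sup>2 * k"
      using assms(8) \<open>k > 0\<close> by (simp add: k_def[symmetric] power_mult_distrib)
    have denom: "1 + \<mu>\<^sup>2 * k > 0"
      using \<open>k > 0\<close> by (simp add: add_pos_nonneg)
    have g: "\<gamma>\<^sub>n = (y\<^sub>n + \<mu> * k * y\<^sub>r) / (1 + \<mu>\<^sup>2 * k)"
      using assms(10) by (simp add: hat tilde)
    have g_eq: "\<gamma>\<^sub>n * (1 + \<mu>\<^sup>2 * k) = y\<^sub>n + \<mu> * k * y\<^sub>r"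
      using denom unfolding g by simp
    have "0 \<le> \<gamma>\<^sub>n"
      using lower denom unfolding g hat by simp
    \<comment> \<open>Multiplying by the positive denominator turns the sign of the residual into
      the upper bound on y_n.\<close>
    have "(y\<^sub>r - \<mu> * \<gamma>\<^sub>n) * (1 + \<mu>\<^sup>2 * k) = y\<^sub>r * (1 + \<mu>\<^sup>2 * k) - \<mu> * (\<gamma>\<^sub>n * (1 + \<mu>\<^sup>2 * k))"
      by (simp add: algebra_simps)
    also have "\<dots> = y\<^sub>r - \<mu> * y\<^sub>n"
      unfolding g_eq by (simp add: power2_eq_square algebra_simps)
    finally have "0 \<le> (y\<^sub>r - \<mu> * \<gamma>\<^sub>n) * (1 + \<mu>\<^sup>2 * k)"
      using upper' by simp
    then have "\<mu> * \<gamma>\<^sub>n \<le> y\<^sub>r"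
      using denom by (simp add: zero_le_mult_iff)
    \<comment> \<open>This is the stationarity condition divided by \<open>R\<^sub>n\<close>: the
      formula for \<open>\<gamma>\<^sub>n\<close> is its solution.\<close>
    have "\<gamma>\<^sub>n - y\<^sub>n = \<mu> * k * (y\<^sub>r - \<mu> * \<gamma>\<^sub>n)"
      using g_eq by (simp add: power2_eq_square algebra_simps)
    then have "R\<^sub>n * (\<gamma>\<^sub>n - y\<^sub>n) = \<mu> * R\<^sub>t * (y\<^sub>r - \<mu> * \<gamma>\<^sub>n)"
      by (simp add: Rt)
    with assms(1-3) \<open>norm t_hat = 1\<close> \<open>0 \<le> \<gamma>\<^sub>n\<close> \<open>\<mu> * \<gamma>\<^sub>n \<le> y\<^sub>r\<close> show ?thesis
      unfolding assms(4,5) y by (intro allI arg_min_friction_cone_sliding)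
  qed
  \<comment> \<open>The bound is not strict, so that the boundary between sliding and no contact is
    covered in the existence claim.\<close>
  have separation: "?argmin 0" if "y\<^sub>n \<le> - \<mu>_hat * y\<^sub>r"
  proof -
    have "R\<^sub>n * y\<^sub>n \<le> - (\<mu> * R\<^sub>t * norm y\<^sub>t)"
      using that assms(3,6,9) by (simp add: field_simps)
    with assms(1-3) show ?thesis
      unfolding assms(4,5) by (intro allI arg_min_friction_cone_separation)
  qed
  have "y\<^sub>r \<le> \<mu> * y\<^sub>n \<or> y\<^sub>n \<le> y\<^sub>r / \<mu>"
    using \<open>\<mu> > 0\<close> by (auto simp: field_simps)
  then have "\<exists>p. ?argmin p"
    using stiction sliding separation by (meson not_less)
  then have "\<exists>!\<gamma>. is_arg_min (proj_objective R (y\<^sub>t, y\<^sub>n)) (\<lambda>\<gamma>. \<gamma> \<in> F) \<gamma>"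
    by auto
  moreover have "proj R F (y\<^sub>t, y\<^sub>n) = p" if "?argmin p" for p
    using that by (intro proj_eqI) blast
  ultimately show ?thesis
    using stiction sliding separation by (meson less_imp_le)
qed

end
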